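(* Let $p>4$ be an odd integer with $3\nmid p$ and let $a$ be a positive integer. Then the square $(a\times a)$ can be tiled with $(2\times 2)$, $(3\times 3)$ and $(p\times p)$ squares if $a\ge 3p+2$. Moreover, $(a\times a)$ can be tiled with $(2\times 2)$, $(3\times 3)$ and $(5\times 5)$ squares if and only if $a\ne 1,7$, and $(a\times a)$ can be tiled with $(2\times 2)$, $(3\times 3)$ and $(7\times 7)$ squares if and only if $a\ne 1,5,11$.
   Context: $(a\times a)$ denotes the square $[0,a]\times[0,a]\subseteq\mathbb{R}^2$. A rectangle is tiled with bricks $B_1,\dots,B_k$ if it is the union of finitely many translated copies of the $B_i$ with pairwise disjoint interiors. *)

theory Defs imports "HOL-Analysis.Analysis" begin

definition rect :: "real \<Rightarrow> real \<Rightarrow> (real \<times> real) set" where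
  "rect a b = {0..a} \<times> {0..b}"

abbreviation square :: "real \<Rightarrow> (real \<times> real) set" where
  "square a \<equiv> rect a a"

(* Translations are by arbitrary real vectors. The tiles form a set rather than an indexed
   family; this loses nothing for bricks with nonempty interior, since a tile cannot be
   repeated when interiors are disjoint. Not every brick has to be used. *)
definition tiled_with :: "(real \<times> real) set \<Rightarrow> (real \<times> real) set set \<Rightarrow> bool" where
  "tiled_with R Bs \<longleftrightarrow>
     (\<exists>T. finite T \<and> (\<forall>t\<in>T. \<exists>B\<in>Bs. \<exists>v. t = (+) v ` B) \<and>
          pairwise (\<lambda>s t. disjnt (interior s) (interior t)) T \<and> \<Union>T = R)"

end

theory Submission imports Defs begin

text \<open>Bricks with a side divisible by 6 are tiled by 2- and 3-squares, so a tiled square can be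
  enlarged by multiples of 6. A square of side prime to 6 is congruent to \<open>p\<close> or to \<open>2p + 3\<close>
  modulo 6, and the square of side \<open>2p + 3\<close> is tiled by a pinwheel and strips of width 6.

  Conversely, weigh the cell \<open>(k, l)\<close> by \<open>(-1)\<^sup>k g(l)\<close>, where \<open>g\<close> has period 3 and mean 0.
  The 2- and 3-squares have weight 0, a square of side prime to 6 does not for suitable \<open>g\<close>,
  and in the exceptional cases at most one large square fits. Comparing weights, also with the
  coordinates exchanged, excludes all positions of the large square except the centre of the
  \<open>7 \<times> 7\<close> square, where it leaves a border too thin for 2-squares.\<close>

section \<open>Assembling tilings from tiled pieces\<close>

lemma tiled_with_self:
  assumes "B \<in> Bs"
  shows "tiled_with B Bs"
proof -
  have "B = (+) 0 ` B" by simp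
  then have "\<exists>B'\<in>Bs. \<exists>v. B = (+) v ` B'" using assms by blast
  then show ?thesis
    unfolding tiled_with_def by (intro exI[of _ "{B}"]) simp
qed

text \<open>Tilings of the pieces are merged. Tiles from different pieces have disjoint interiors
  because the interior of a tile lies in the interior of its piece.\<close>

lemma tiled_with_Union:
  assumes "finite F" and tiled: "\<And>R. R \<in> F \<Longrightarrow> tiled_with R Bs"
    and disj: "pairwise (\<lambda>R S. disjnt (interior R) (interior S)) F"
  shows "tiled_with (\<Union>F) Bs"
proof -
  have "\<forall>R\<in>F. \<exists>T. finite T \<and> (\<forall>t\<in>T. \<exists>B\<in>Bs. \<exists>v. t = (+) v ` B) \<and>
          pairwise (\<lambda>s t. disjnt (interior s) (interior t)) T \<and> \<Union>T = R"
    using tiled unfolding tiled_with_def by blast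
  then obtain T where T: "\<And>R. R \<in> F \<Longrightarrow> finite (T R)"
      "\<And>R t. R \<in> F \<Longrightarrow> t \<in> T R \<Longrightarrow> \<exists>B\<in>Bs. \<exists>v. t = (+) v ` B"
      "\<And>R. R \<in> F \<Longrightarrow> pairwise (\<lambda>s t. disjnt (interior s) (interior t)) (T R)"
      "\<And>R. R \<in> F \<Longrightarrow> \<Union>(T R) = R"
    by metis
  have "disjnt (interior s) (interior t)"
    if "R \<in> F" "s \<in> T R" "S \<in> F" "t \<in> T S" "s \<noteq> t" for R S s t
  proof (cases "R = S")
    case True
    then show ?thesis using that T(3) by (auto simp: pairwise_def)
  next
    case False
    have "interior s \<subseteq> interior R" "interior t \<subseteq> interior S"
      using that T(4) by (auto intro!: interior_mono)
    moreover have "disjnt (interior R) (interior S)"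
      using disj False that by (auto simp: pairwise_def)
    ultimately show ?thesis by (meson disjnt_subset1 disjnt_subset2)
  qed
  then have "pairwise (\<lambda>s t. disjnt (interior s) (interior t)) (\<Union>R\<in>F. T R)"
    by (auto simp: pairwise_def)
  moreover have "\<Union>(\<Union>R\<in>F. T R) = \<Union>F" using T(4) by blast
  ultimately show ?thesis
    unfolding tiled_with_def using \<open>finite F\<close> T(1,2)
    by (intro exI[of _ "\<Union>R\<in>F. T R"]) auto
qed

lemma translate_rect: "(+) (x, y) ` rect w h = {x..x + w} \<times> {y..y + h}"
proof -
  have "(+) (x, y) ` rect w h = (\<lambda>(s, t). (x + s, y + t)) ` ({0..w} \<times> {0..h})"
    by (auto simp: rect_def image_iff)
  also have "\<dots> = ((+) x ` {0..w}) \<times> ((+) y ` {0..h})"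
    unfolding image_paired_Times ..
  finally show ?thesis by (simp add: add.commute)
qed

lemma tiled_with_translate:
  assumes "tiled_with R Bs"
  shows "tiled_with ((+) v ` R) Bs"
proof -
  obtain T where T: "finite T" "\<forall>t\<in>T. \<exists>B\<in>Bs. \<exists>u. t = (+) u ` B"
      "pairwise (\<lambda>s t. disjnt (interior s) (interior t)) T" "\<Union>T = R"
    using assms unfolding tiled_with_def by blast
  let ?T = "(`) ((+) v) ` T"
  have "\<forall>t\<in>?T. \<exists>B\<in>Bs. \<exists>u. t = (+) u ` B"
  proof
    fix t assume "t \<in> ?T"
    then obtain s where s: "s \<in> T" "t = (+) v ` s" by blast
    obtain B u where B: "B \<in> Bs" "s = (+) u ` B" using s(1) T(2) by blast
    have "t = (+) (v + u) ` B" unfolding s(2) B(2) image_image by (simp add: add.assoc)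
    then show "\<exists>B\<in>Bs. \<exists>u. t = (+) u ` B" using B(1) by blast
  qed
  moreover have "pairwise (\<lambda>s t. disjnt (interior s) (interior t)) ?T"
    unfolding pairwise_image
    by (rule pairwise_mono[OF T(3)]) (auto simp: interior_translation disjnt_iff)
  moreover have "\<Union>?T = (+) v ` R" using T(4) by blast
  ultimately show ?thesis
    unfolding tiled_with_def using \<open>finite T\<close> by (intro exI[of _ ?T]) blast
qed

lemma tiled_with_box:
  assumes "tiled_with (rect w h) Bs" and "x' = x + w" and "y' = y + h"
  shows "tiled_with ({x..x'} \<times> {y..y'}) Bs"
  using tiled_with_translate[OF assms(1), of "(x, y)"] assms(2,3) by (simp add: translate_rect)

lemma tiled_with_hstack:
  assumes "tiled_with (rect a c) Bs" "tiled_with (rect b c) Bs" "a \<ge> 0" "b \<ge> 0"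
  shows "tiled_with (rect (a + b) c) Bs"
proof -
  let ?F = "{{0..a} \<times> {0..c}, {a..a + b} \<times> {0..c}}"
  have "tiled_with (\<Union>?F) Bs"
    by (rule tiled_with_Union)
      (use assms in \<open>auto intro: tiled_with_box[OF assms(1)] tiled_with_box[OF assms(2)]
        simp: pairwise_insert interior_Times disjnt_iff\<close>)
  moreover have "\<Union>?F = rect (a + b) c" using assms by (auto simp: rect_def)
  ultimately show ?thesis by simp
qed

lemma tiled_with_vstack:
  assumes "tiled_with (rect c a) Bs" "tiled_with (rect c b) Bs" "a \<ge> 0" "b \<ge> 0"
  shows "tiled_with (rect c (a + b)) Bs"
proof -
  let ?F = "{{0..c} \<times> {0..a}, {0..c} \<times> {a..a + b}}"
  have "tiled_with (\<Union>?F) Bs"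
    by (rule tiled_with_Union)
      (use assms in \<open>auto intro: tiled_with_box[OF assms(1)] tiled_with_box[OF assms(2)]
        simp: pairwise_insert interior_Times disjnt_iff\<close>)
  moreover have "\<Union>?F = rect c (a + b)" using assms by (auto simp: rect_def)
  ultimately show ?thesis by simp
qed

lemma tiled_with_multiple:
  assumes "tiled_with (rect a b) Bs" "a \<ge> 0" "b \<ge> 0" "m > 0" "n > 0"
  shows "tiled_with (rect (real m * a) (real n * b)) Bs"
proof -
  have row: "tiled_with (rect (real m * a) b) Bs"
    using \<open>m > 0\<close>
  proof (induction m rule: nat_induct_non_zero)
    case (Suc m)
    then show ?case
      using tiled_with_hstack[OF assms(1), of "real m * a"] assms(2) by (simp add: algebra_simps)
  qed (use assms in simp)
  show ?thesis
    using \<open>n > 0\<close>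
  proof (induction n rule: nat_induct_non_zero)
    case (Suc n)
    then show ?case
      using tiled_with_vstack[OF row, of "real n * b"] assms(3) by (simp add: algebra_simps)
  qed (use row in simp)
qed

lemma tiled_with_multiple_int:
  fixes a b c d :: int
  assumes "tiled_with (rect (of_int a) (of_int b)) Bs" "a > 0" "b > 0"
    and "a dvd c" "b dvd d" "c > 0" "d > 0"
  shows "tiled_with (rect (of_int c) (of_int d)) Bs"
proof -
  obtain m n where mn: "c = a * m" "d = b * n" using assms(4,5) by (auto elim!: dvdE)
  then have "m > 0" "n > 0" using assms by (auto simp: zero_less_mult_iff)
  then show ?thesis
    using tiled_with_multiple[OF assms(1), of "nat m" "nat n"] assms(2,3) mn
    by (simp add: mult.commute)
qed

section \<open>Constructions from 2-squares, 3-squares and one larger odd square\<close>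

context
  fixes Bs :: "(real \<times> real) set set"
  assumes squares: "square 2 \<in> Bs" "square 3 \<in> Bs"
begin

lemma tiled_with_even:
  fixes m n :: int
  assumes "even m" "even n" "m > 0" "n > 0"
  shows "tiled_with (rect (of_int m) (of_int n)) Bs"
  using tiled_with_multiple_int[of 2 2] assms tiled_with_self[OF squares(1)] by simp

lemma tiled_with_3_dvd:
  fixes m n :: int
  assumes "3 dvd m" "3 dvd n" "m > 0" "n > 0"
  shows "tiled_with (rect (of_int m) (of_int n)) Bs"
  using tiled_with_multiple_int[of 3 3] assms tiled_with_self[OF squares(2)] by simp

text \<open>For even \<open>n\<close>, 2-squares suffice. For odd \<open>n\<close>, a strip of
  3-squares leaves a brick with even sides, which is empty exactly when
  \<open>n = 3\<close>.\<close>

lemma tiled_with_6_dvd: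
  fixes m n :: int
  assumes "6 dvd m" "m > 0" "n \<ge> 2"
  shows "tiled_with (rect (of_int m) (of_int n)) Bs \<and> tiled_with (rect (of_int n) (of_int m)) Bs"
proof -
  have m: "even m" "3 dvd m" using assms by presburger+
  show ?thesis
  proof (cases "even n")
    case True
    then show ?thesis using tiled_with_even m assms by simp
  next
    case False
    show ?thesis
    proof (cases "n = 3")
      case True
      then show ?thesis using tiled_with_3_dvd[of m 3] tiled_with_3_dvd[of 3 m] m assms by simp
    next
      case False
      with \<open>odd n\<close> assms have n: "even (n - 3)" "n - 3 > 0" by presburger+
      have "tiled_with (rect (of_int m) (3 + of_int (n - 3))) Bs"
        by (rule tiled_with_vstack)
          (use tiled_with_3_dvd[of m 3] tiled_with_even[of m "n - 3"] m n assms in auto)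
      moreover have "tiled_with (rect (3 + of_int (n - 3)) (of_int m)) Bs"
        by (rule tiled_with_hstack)
          (use tiled_with_3_dvd[of 3 m] tiled_with_even[of "n - 3" m] m n assms in auto)
      ultimately show ?thesis by simp
    qed
  qed
qed

lemma tiled_with_widen:
  fixes m m' n :: int
  assumes "tiled_with (rect (of_int m) (of_int n)) Bs" "m \<ge> 0" "n \<ge> 2" "m \<le> m'" "6 dvd m' - m"
  shows "tiled_with (rect (of_int m') (of_int n)) Bs"
proof (cases "m = m'")
  case False
  then have "tiled_with (rect (of_int m + of_int (m' - m)) (of_int n)) Bs"
    by (intro tiled_with_hstack) (use assms tiled_with_6_dvd[of "m' - m" n] in auto)
  then show ?thesis by simp
qed (use assms in simp)

lemma tiled_with_heighten:
  fixes m n n' :: int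
  assumes "tiled_with (rect (of_int m) (of_int n)) Bs" "m \<ge> 2" "n \<ge> 0" "n \<le> n'" "6 dvd n' - n"
  shows "tiled_with (rect (of_int m) (of_int n')) Bs"
proof (cases "n = n'")
  case False
  then have "tiled_with (rect (of_int m) (of_int n + of_int (n' - n))) Bs"
    by (intro tiled_with_vstack) (use assms tiled_with_6_dvd[of "n' - n" m] in auto)
  then show ?thesis by simp
qed (use assms in simp)

text \<open>The difference of the two squares is an L-shape, cut into two strips whose thickness is
  a multiple of 6.\<close>

lemma tiled_with_square_enlarge:
  fixes m n :: int
  assumes "tiled_with (square (of_int m)) Bs" "m \<ge> 2" "m \<le> n" "6 dvd n - m"
  shows "tiled_with (square (of_int n)) Bs"
  using tiled_with_heighten[OF tiled_with_widen[OF assms(1)]] assms by simp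

text \<open>Two $p$-squares at opposite corners and two $c \times (p+3)$ bricks at the other two corners
  wind around a central $(p-c) \times 3$ brick.\<close>

lemma tiled_with_pinwheel:
  fixes p c :: int
  assumes p: "square (of_int p) \<in> Bs" "odd p" and c: "even c" "3 dvd p - c" "0 < c" "c < p"
  shows "tiled_with (rect (of_int (p + c)) (of_int (2 * p + 3))) Bs"
proof -
  define P C where "P = real_of_int p" and "C = real_of_int c"
  let ?F = "{{0..P} \<times> {0..P}, {P..P + C} \<times> {0..P + 3}, {C..P + C} \<times> {P + 3..2 * P + 3},
      {0..C} \<times> {P..2 * P + 3}, {C..P} \<times> {P..P + 3}}"
  have PC: "0 < C" "C < P" using c by (auto simp: P_def C_def)
  have P: "tiled_with (rect P P) Bs" using p tiled_with_self by (simp add: P_def)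
  \<comment> \<open>The side bricks have even sides and take 2-squares. The sides of the central
    brick are multiples of 3, so it takes 3-squares.\<close>
  have side: "tiled_with (rect C (P + 3)) Bs"
    using tiled_with_even[of c "p + 3"] p c by (simp add: P_def C_def)
  have centre: "tiled_with (rect (P - C) 3) Bs"
    using tiled_with_3_dvd[of "p - c" 3] c by (simp add: P_def C_def)
  have "tiled_with (\<Union>?F) Bs"
  proof (rule tiled_with_Union)
    show "tiled_with R Bs" if "R \<in> ?F" for R
      using that by (auto intro: tiled_with_box[OF P] tiled_with_box[OF side] tiled_with_box[OF centre])
    show "pairwise (\<lambda>R S. disjnt (interior R) (interior S)) ?F"
      using PC by (auto simp: pairwise_insert interior_Times disjnt_iff)
  qed simp
  moreover have "\<Union>?F = rect (P + C) (2 * P + 3)"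
    using PC by (auto simp: rect_def)
  ultimately show ?thesis by (simp add: P_def C_def)
qed

lemma tiled_with_square_2p_plus_3:
  fixes p :: int
  assumes "square (of_int p) \<in> Bs" "p > 4" "odd p" "\<not> 3 dvd p"
  shows "tiled_with (square (of_int (2 * p + 3))) Bs"
proof -
  \<comment> \<open>\<open>c\<close> is the member of {2, 4} congruent to \<open>p\<close> modulo 3.
    The pinwheel then falls short of the full width by \<open>p + 3 - c\<close>, which is even and
    divisible by 3.\<close>
  obtain c where c: "even c" "3 dvd p - c" "0 < c" "c < p" "6 dvd (2 * p + 3) - (p + c)" "c \<le> p + 3"
  proof (cases "p mod 3 = 2")
    case True
    show ?thesis by (rule that[of 2]) (use True assms in presburger)+
  next
    case False
    show ?thesis by (rule that[of 4]) (use False assms in presburger)+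
  qed
  have "tiled_with (rect (of_int (p + c)) (of_int (2 * p + 3))) Bs"
    by (rule tiled_with_pinwheel) (use assms c in auto)
  then show ?thesis
    by (rule tiled_with_widen) (use assms c in auto)
qed

lemma tiled_with_square_sufficient:
  fixes p a :: int
  assumes p: "square (of_int p) \<in> Bs" "p > 4" "odd p" "\<not> 3 dvd p"
    and a: "a > 0" "even a \<or> 3 dvd a \<or> a \<ge> p \<and> 6 dvd a - p \<or> a \<ge> 2 * p + 3"
  shows "tiled_with (square (of_int a)) Bs"
proof -
  consider "even a" | "3 dvd a" | "a \<ge> p" "6 dvd a - p" | "a \<ge> 2 * p + 3" "6 dvd a - (2 * p + 3)"
  proof -
    \<comment> \<open>The residues prime to 6 are 1 and -1. Since \<open>p\<close> is odd,
      \<open>3 * p + 3\<close> is divisible by 6, so \<open>2 * p + 3\<close> is congruent to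
      \<open>-p\<close> and the two large squares represent both residues.\<close>
    have "even a \<or> 3 dvd a \<or> a \<ge> p \<and> 6 dvd a - p \<or> a \<ge> 2 * p + 3 \<and> 6 dvd a - (2 * p + 3)"
      using p(2-) a by presburger
    then show ?thesis using that by blast
  qed
  then show ?thesis
  proof cases
    case 1
    then show ?thesis using tiled_with_even a by simp
  next
    case 2
    then show ?thesis using tiled_with_3_dvd a by simp
  next
    case 3
    then show ?thesis
      using tiled_with_square_enlarge[OF tiled_with_self[OF p(1)]] p by simp
  next
    case 4
    then show ?thesis
      using tiled_with_square_enlarge[OF tiled_with_square_2p_plus_3[OF p]] p by simp
  qed
qed

end

section \<open>From tilings of the plane square to partitions of integer cells\<close>

text \<open>Since \<open>n\<close> is an integer, a lattice that misses the left endpoint also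
  misses the right one, so the closed and the open interval contain the same lattice points.\<close>

lemma shifted_lattice_interval:
  fixes w \<theta> :: real and k n :: int
  assumes "\<And>k::int. of_int k + \<theta> \<noteq> w"
  shows "of_int k + \<theta> \<in> {w..w + of_int n} \<longleftrightarrow> k \<in> {\<lceil>w - \<theta>\<rceil>..<\<lceil>w - \<theta>\<rceil> + n}"
    and "of_int k + \<theta> \<in> {w<..<w + of_int n} \<longleftrightarrow> k \<in> {\<lceil>w - \<theta>\<rceil>..<\<lceil>w - \<theta>\<rceil> + n}"
proof -
  have "of_int k + \<theta> \<noteq> w" "of_int (k - n) + \<theta> \<noteq> w" using assms by blast+
  moreover have "\<lceil>w - \<theta>\<rceil> \<le> k \<longleftrightarrow> w - \<theta> \<le> of_int k" by (rule ceiling_le_iff)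
  moreover have "k - n < \<lceil>w - \<theta>\<rceil> \<longleftrightarrow> of_int (k - n) < w - \<theta>" by (rule less_ceiling_iff)
  ultimately show "of_int k + \<theta> \<in> {w..w + of_int n} \<longleftrightarrow> k \<in> {\<lceil>w - \<theta>\<rceil>..<\<lceil>w - \<theta>\<rceil> + n}"
    and "of_int k + \<theta> \<in> {w<..<w + of_int n} \<longleftrightarrow> k \<in> {\<lceil>w - \<theta>\<rceil>..<\<lceil>w - \<theta>\<rceil> + n}"
    by auto
qed

text \<open>Choosing the offset \<open>\<theta>\<close> so that no point of the shifted lattice lies on the boundary
  of a tile, every tile with integer side \<open>n\<close>, wherever it is placed, contains exactly
  \<open>n\<close> by \<open>n\<close> consecutive lattice points. Thus tile positions need not be shown to be integral.\<close>

lemma tiled_square_cells: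
  fixes a :: int and N :: "int set"
  assumes tiled: "tiled_with (square (of_int a)) ((\<lambda>n. square (of_int n)) ` N)"
  obtains D :: "(int \<times> int \<times> int) set"
  where "finite D" "\<And>i j n. (i, j, n) \<in> D \<Longrightarrow> n \<in> N"
    "(\<Union>(i, j, n)\<in>D. {i..<i + n} \<times> {j..<j + n}) = {0..<a} \<times> {0..<a}"
    "disjoint_family_on (\<lambda>(i, j, n). {i..<i + n} \<times> {j..<j + n}) D"
proof -
  obtain T where T: "finite T" "\<forall>t\<in>T. \<exists>B\<in>(\<lambda>n. square (of_int n)) ` N. \<exists>v. t = (+) v ` B"
      "pairwise (\<lambda>s t. disjnt (interior s) (interior t)) T" "\<Union>T = square (of_int a)"
    using tiled unfolding tiled_with_def by blast
  have "\<exists>u v. \<exists>n\<in>N. t = {u..u + of_int n} \<times> {v..v + of_int n}" if t_T: "t \<in> T" for t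
  proof -
    obtain n x y where "n \<in> N" "t = (+) (x, y) ` square (of_int n)" using T(2) t_T by fastforce
    then show ?thesis unfolding translate_rect by blast
  qed
  then obtain u v n where t: "\<And>t. t \<in> T \<Longrightarrow> n t \<in> N"
      "\<And>t. t \<in> T \<Longrightarrow> t = {u t..u t + of_int (n t)} \<times> {v t..v t + of_int (n t)}"
    by metis
  \<comment> \<open>Only finitely many offsets are bad, namely the fractional parts of the tile
    corner coordinates.\<close>
  have "infinite ({0<..<1} - frac ` (u ` T \<union> v ` T))"
    using T(1) by (intro Diff_infinite_finite) simp_all
  then obtain \<theta> where \<theta>: "0 < \<theta>" "\<theta> < 1" "\<theta> \<notin> frac ` (u ` T \<union> v ` T)"
    by (metis DiffE ex_in_conv finite.emptyI greaterThanLessThan_iff)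
  have generic: "k + \<theta> \<noteq> u t" "k + \<theta> \<noteq> v t" if "t \<in> T" "k \<in> \<int>" for t k
  proof -
    have "frac (k + \<theta>) = \<theta>" using that(2) \<theta> by (simp add: frac_add_int_left frac_eq)
    then show "k + \<theta> \<noteq> u t" "k + \<theta> \<noteq> v t" using \<theta>(3) that(1) by (metis UnI1 UnI2 imageI)+
  qed
  define cells where "cells = (\<lambda>(i::int, j::int, n). {i..<i + n} \<times> {j..<j + n})"
  define pos where "pos t = (\<lceil>u t - \<theta>\<rceil>, \<lceil>v t - \<theta>\<rceil>, n t)" for t
  \<comment> \<open>Membership in the closed tile gives the covering of the cells, membership in its
    interior their disjointness.\<close>
  have cells_iff: "(k, l) \<in> cells (pos t) \<longleftrightarrow> (of_int k + \<theta>, of_int l + \<theta>) \<in> t"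
    and cells_interior: "(k, l) \<in> cells (pos t) \<longleftrightarrow> (of_int k + \<theta>, of_int l + \<theta>) \<in> interior t"
    if "t \<in> T" for k l t
  proof -
    have g: "\<And>k::int. of_int k + \<theta> \<noteq> u t" "\<And>k::int. of_int k + \<theta> \<noteq> v t"
      using generic[OF that] by auto
    have "(k, l) \<in> cells (pos t) \<longleftrightarrow>
        (of_int k + \<theta>, of_int l + \<theta>) \<in> {u t..u t + of_int (n t)} \<times> {v t..v t + of_int (n t)}"
      unfolding mem_Times_iff fst_conv snd_conv shifted_lattice_interval(1)[OF g(1)]
        shifted_lattice_interval(1)[OF g(2)] by (simp add: cells_def pos_def)
    then show "(k, l) \<in> cells (pos t) \<longleftrightarrow> (of_int k + \<theta>, of_int l + \<theta>) \<in> t"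
      using t(2)[OF that] by simp
    have "(k, l) \<in> cells (pos t) \<longleftrightarrow> (of_int k + \<theta>, of_int l + \<theta>) \<in>
        {u t<..<u t + of_int (n t)} \<times> {v t<..<v t + of_int (n t)}"
      unfolding mem_Times_iff fst_conv snd_conv shifted_lattice_interval(2)[OF g(1)]
        shifted_lattice_interval(2)[OF g(2)] by (simp add: cells_def pos_def)
    moreover have "interior t = {u t<..<u t + of_int (n t)} \<times> {v t<..<v t + of_int (n t)}"
      by (subst t(2)[OF that]) (simp add: interior_Times)
    ultimately show "(k, l) \<in> cells (pos t) \<longleftrightarrow> (of_int k + \<theta>, of_int l + \<theta>) \<in> interior t"
      by simp
  qed
  have in_square: "of_int k + \<theta> \<in> {0..real_of_int a} \<longleftrightarrow> k \<in> {0..<a}" for k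
    using \<theta>(1,2) by auto
  have "(k, l) \<in> (\<Union>d\<in>pos ` T. cells d) \<longleftrightarrow> (k, l) \<in> {0..<a} \<times> {0..<a}" for k l
  proof -
    have "(k, l) \<in> (\<Union>d\<in>pos ` T. cells d) \<longleftrightarrow> (of_int k + \<theta>, of_int l + \<theta>) \<in> \<Union>T"
      using cells_iff by auto
    then show ?thesis unfolding T(4) rect_def mem_Times_iff fst_conv snd_conv in_square .
  qed
  then have "(\<Union>d\<in>pos ` T. cells d) = {0..<a} \<times> {0..<a}" by (intro set_eqI) (metis surj_pair)
  moreover have "disjoint_family_on cells (pos ` T)"
    unfolding disjoint_family_on_def
  proof (intro ballI impI, rule equals0I)
    fix d e x assume *: "d \<in> pos ` T" "e \<in> pos ` T" "d \<noteq> e" "x \<in> cells d \<inter> cells e"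
    obtain s t where st: "s \<in> T" "t \<in> T" "d = pos s" "e = pos t" using *(1,2) by blast
    obtain k l where "x = (k, l)" by fastforce
    then have "(of_int k + \<theta>, of_int l + \<theta>) \<in> interior s \<inter> interior t"
      using * st cells_interior by auto
    moreover have "s \<noteq> t" using st *(3) by auto
    then have "disjnt (interior s) (interior t)" by (rule pairwiseD[OF T(3) st(1,2)])
    ultimately show False by (auto simp: disjnt_def)
  qed
  ultimately show thesis
    by (intro that[of "pos ` T"]) (use T(1) t(1) in \<open>auto simp: cells_def pos_def\<close>)
qed

section \<open>Product weights on cells\<close>

definition consecutive_sum :: "(int \<Rightarrow> int) \<Rightarrow> int \<Rightarrow> int \<Rightarrow> int" where
  "consecutive_sum f i n = (\<Sum>k\<in>{i..<i + n}. f k)"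

text \<open>Both sides add up \<open>f k * g l\<close> over all cells of the large square. On each
  square block this double sum factors into two one-dimensional sums.\<close>

lemma consecutive_sum_weight:
  fixes D :: "(int \<times> int \<times> int) set"
  assumes "finite D"
    and cover: "(\<Union>(i, j, n)\<in>D. {i..<i + n} \<times> {j..<j + n}) = {0..<a} \<times> {0..<a}"
    and disj: "disjoint_family_on (\<lambda>(i, j, n). {i..<i + n} \<times> {j..<j + n}) D"
  shows "consecutive_sum f 0 a * consecutive_sum g 0 a =
    (\<Sum>(i, j, n)\<in>D. consecutive_sum f i n * consecutive_sum g j n)"
proof -
  have *: "consecutive_sum f i n * consecutive_sum g j n =
      (\<Sum>(k, l)\<in>{i..<i + n} \<times> {j..<j + n}. f k * g l)" for i j n
    by (simp add: consecutive_sum_def sum_product sum.cartesian_product)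
  have "consecutive_sum f 0 a * consecutive_sum g 0 a =
      (\<Sum>(k, l)\<in>(\<Union>d\<in>D. (\<lambda>(i, j, n). {i..<i + n} \<times> {j..<j + n}) d). f k * g l)"
    unfolding * cover by simp
  also have "\<dots> = (\<Sum>d\<in>D. \<Sum>(k, l)\<in>(\<lambda>(i, j, n). {i..<i + n} \<times> {j..<j + n}) d. f k * g l)"
    by (rule sum.UNION_disjoint)
      (use \<open>finite D\<close> disj in \<open>auto simp: disjoint_family_on_def\<close>)
  finally show ?thesis unfolding * by (simp add: case_prod_unfold)
qed

text \<open>Two blocks of side \<open>q\<close> cannot be disjoint inside a square of side less than
  \<open>2 * q\<close>. The position in case \<open>one\<close> is fixed before \<open>f\<close> and
  \<open>g\<close>, so equations from several weights constrain the same block.\<close>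

lemma single_large_tile:
  fixes D :: "(int \<times> int \<times> int) set"
  assumes "finite D"
    and cover: "(\<Union>(i, j, n)\<in>D. {i..<i + n} \<times> {j..<j + n}) = {0..<a} \<times> {0..<a}"
    and disj: "disjoint_family_on (\<lambda>(i, j, n). {i..<i + n} \<times> {j..<j + n}) D"
    and q: "0 < q" "a < 2 * q"
  defines "negligible_small \<equiv> \<lambda>f g. \<forall>(i, j, n)\<in>D. n \<noteq> q \<longrightarrow>
    consecutive_sum f i n * consecutive_sum g j n = 0"
  obtains (none) "\<And>f g. negligible_small f g \<Longrightarrow> consecutive_sum f 0 a * consecutive_sum g 0 a = 0"
  | (one) i j where "(i, j, q) \<in> D" "0 \<le> i" "i + q \<le> a" "0 \<le> j" "j + q \<le> a"
      "\<And>f g. negligible_small f g \<Longrightarrow> consecutive_sum f 0 a * consecutive_sum g 0 a =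
        consecutive_sum f i q * consecutive_sum g j q"
proof -
  define L where "L = {(i, j, n) \<in> D. n = q}"
  have "L \<subseteq> D" by (auto simp: L_def)
  have sum_L: "consecutive_sum f 0 a * consecutive_sum g 0 a =
      (\<Sum>(i, j, n)\<in>L. consecutive_sum f i n * consecutive_sum g j n)" if "negligible_small f g" for f g
    unfolding consecutive_sum_weight[OF assms(1) cover disj]
    by (rule sum.mono_neutral_right)
      (use \<open>finite D\<close> that in \<open>auto simp: L_def negligible_small_def\<close>)
  have bounds: "0 \<le> i \<and> i + q \<le> a \<and> 0 \<le> j \<and> j + q \<le> a" if "(i, j, q) \<in> D" for i j
  proof -
    have "{i..<i + q} \<times> {j..<j + q} \<subseteq> {0..<a} \<times> {0..<a}" using that cover by blast
    moreover have "(i, j) \<in> {i..<i + q} \<times> {j..<j + q}"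
      "(i + q - 1, j + q - 1) \<in> {i..<i + q} \<times> {j..<j + q}" using q by auto
    ultimately have "(i, j) \<in> {0..<a} \<times> {0..<a}" "(i + q - 1, j + q - 1) \<in> {0..<a} \<times> {0..<a}"
      by blast+
    then show ?thesis by auto
  qed
  show thesis
  proof (cases "L = {}")
    case True
    then show ?thesis using none sum_L by simp
  next
    case False
    then obtain i j where ij: "(i, j, q) \<in> D" by (auto simp: L_def)
    have "d = (i, j, q)" if d_L: "d \<in> L" for d
    proof (rule ccontr)
      assume "d \<noteq> (i, j, q)"
      obtain i' j' where d: "d = (i', j', q)" "(i', j', q) \<in> D" using d_L by (auto simp: L_def)
      \<comment> \<open>The offsets lie between 0 and \<open>a - q\<close>, hence below
        \<open>q\<close>, so every such block contains the cell
        \<open>(q - 1, q - 1)\<close>.\<close>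
      have "(q - 1, q - 1) \<in> ({i..<i + q} \<times> {j..<j + q}) \<inter> ({i'..<i' + q} \<times> {j'..<j' + q})"
        using bounds[OF ij] bounds[OF d(2)] q by auto
      moreover have "({i'..<i' + q} \<times> {j'..<j' + q}) \<inter> ({i..<i + q} \<times> {j..<j + q}) = {}"
        using disjoint_family_onD[OF disj d(2) ij] \<open>d \<noteq> (i, j, q)\<close> d(1) by simp
      ultimately show False by blast
    qed
    then have "L = {(i, j, q)}" using ij by (auto simp: L_def)
    then show ?thesis using one ij bounds[OF ij] sum_L by simp
  qed
qed

lemma consecutive_sum_add:
  assumes "m \<ge> 0" "n \<ge> 0"
  shows "consecutive_sum f i (m + n) = consecutive_sum f i m + consecutive_sum f (i + m) n"
proof -
  have "{i..<i + (m + n)} = {i..<i + m} \<union> {i + m..<i + m + n}" using assms by auto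
  then show ?thesis unfolding consecutive_sum_def by (simp add: sum.union_disjoint)
qed

lemma consecutive_sum_1: "consecutive_sum f i 1 = f i"
proof -
  have "{i..<i + 1} = {i}" by auto
  then show ?thesis by (simp add: consecutive_sum_def)
qed

lemma consecutive_sum_2: "consecutive_sum f i 2 = f i + f (i + 1)"
  using consecutive_sum_add[of 1 1 f i] by (simp add: consecutive_sum_1)

section \<open>Periodic weights annihilating 2- and 3-squares\<close>

definition sign_weight :: "int \<Rightarrow> int" where
  "sign_weight k = (if even k then 1 else -1)"

text \<open>The shift \<open>s\<close> moves the pattern 1, -1, 0. Shifts 0 and 2 form a basis of
  the functions of period 3 and mean 0.\<close>

definition mod3_weight :: "int \<Rightarrow> int \<Rightarrow> int" where
  "mod3_weight s k = (if (k + s) mod 3 = 0 then 1 else if (k + s) mod 3 = 1 then -1 else 0)"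

lemma consecutive_sum_sign_weight:
  "consecutive_sum sign_weight i 2 = 0"
  "n \<ge> 0 \<Longrightarrow> consecutive_sum sign_weight i (n + 2) = consecutive_sum sign_weight i n"
proof -
  show *: "consecutive_sum sign_weight i 2 = 0" for i
    by (simp add: consecutive_sum_2 sign_weight_def)
  show "n \<ge> 0 \<Longrightarrow> consecutive_sum sign_weight i (n + 2) = consecutive_sum sign_weight i n"
    using * by (simp add: consecutive_sum_add)
qed

lemma consecutive_sum_mod3_weight:
  "consecutive_sum (mod3_weight s) i 3 = 0"
  "n \<ge> 0 \<Longrightarrow> consecutive_sum (mod3_weight s) i (n + 3) = consecutive_sum (mod3_weight s) i n"
proof -
  show *: "consecutive_sum (mod3_weight s) i 3 = 0" for i
  proof -
    define r where "r = i + s"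
    consider "r mod 3 = 0" "(r + 1) mod 3 = 1" "(r + 2) mod 3 = 2"
      | "r mod 3 = 1" "(r + 1) mod 3 = 2" "(r + 2) mod 3 = 0"
      | "r mod 3 = 2" "(r + 1) mod 3 = 0" "(r + 2) mod 3 = 1" by atomize_elim presburger
    then have "mod3_weight s i + mod3_weight s (i + 1) + mod3_weight s (i + 2) = 0"
      by cases (simp_all add: mod3_weight_def r_def ac_simps)
    then show ?thesis
      using consecutive_sum_add[of 2 1 "mod3_weight s" i]
      by (simp add: consecutive_sum_1 consecutive_sum_2)
  qed
  show "n \<ge> 0 \<Longrightarrow> consecutive_sum (mod3_weight s) i (n + 3) = consecutive_sum (mod3_weight s) i n"
    using * by (simp add: consecutive_sum_add)
qed

lemma consecutive_sum_sign_weight_odd: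
  "consecutive_sum sign_weight i 5 = sign_weight i"
  "consecutive_sum sign_weight i 7 = sign_weight i"
  "consecutive_sum sign_weight i 11 = sign_weight i"
  using consecutive_sum_sign_weight(2)[of 1 i] consecutive_sum_sign_weight(2)[of 3 i]
    consecutive_sum_sign_weight(2)[of 5 i] consecutive_sum_sign_weight(2)[of 7 i]
    consecutive_sum_sign_weight(2)[of 9 i]
  by (simp_all add: consecutive_sum_1)

lemma consecutive_sum_mod3_weight_prime_to_3:
  "consecutive_sum (mod3_weight s) i 5 = mod3_weight s i + mod3_weight s (i + 1)"
  "consecutive_sum (mod3_weight s) i 7 = mod3_weight s i"
  "consecutive_sum (mod3_weight s) i 11 = mod3_weight s i + mod3_weight s (i + 1)"
  using consecutive_sum_mod3_weight(2)[of 1 s i] consecutive_sum_mod3_weight(2)[of 4 s i]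
    consecutive_sum_mod3_weight(2)[of 2 s i] consecutive_sum_mod3_weight(2)[of 5 s i]
    consecutive_sum_mod3_weight(2)[of 8 s i]
  by (simp_all add: consecutive_sum_1 consecutive_sum_2)

section \<open>The exceptional squares\<close>

lemma not_tiled_with_small_squares:
  fixes a q :: int
  assumes aq: "(a, q) \<in> {(1, 5), (7, 5), (1, 7), (5, 7), (11, 7)}"
  shows "\<not> tiled_with (square (of_int a)) {square 2, square 3, square (of_int q)}"
proof
  assume "tiled_with (square (of_int a)) {square 2, square 3, square (of_int q)}"
  then have "tiled_with (square (of_int a)) ((\<lambda>n. square (of_int n)) ` {2, 3, q})" by simp
  then obtain D where D: "finite D" "\<And>i j n. (i, j, n) \<in> D \<Longrightarrow> n \<in> {2, 3, q}"
    "(\<Union>(i, j, n)\<in>D. {i..<i + n} \<times> {j..<j + n}) = {0..<a} \<times> {0..<a}"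
    "disjoint_family_on (\<lambda>(i, j, n). {i..<i + n} \<times> {j..<j + n}) D"
    by (rule tiled_square_cells) blast
  have small: "\<forall>(i, j, n)\<in>D. n \<noteq> q \<longrightarrow>
      consecutive_sum sign_weight i n * consecutive_sum (mod3_weight s) j n = 0"
      "\<forall>(i, j, n)\<in>D. n \<noteq> q \<longrightarrow>
      consecutive_sum (mod3_weight s) i n * consecutive_sum sign_weight j n = 0" for s
    using consecutive_sum_sign_weight(1) consecutive_sum_mod3_weight(1) by (auto dest!: D(2))
  note sums = consecutive_sum_1 consecutive_sum_sign_weight_odd consecutive_sum_mod3_weight_prime_to_3
  note weights = sign_weight_def mod3_weight_def
  have "0 < q" "a < 2 * q" using aq by auto
  from D(1,3,4) this show False
  proof (cases rule: single_large_tile)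
    case none
    \<comment> \<open>The large square has weight 1 with shift 0 if \<open>a\<close> is 1 or 7, and
      with shift 2 if \<open>a\<close> is 5 or 11.\<close>
    then show False using none[OF small(1)[of 0]] none[OF small(1)[of 2]] aq
      by (auto simp: sums weights)
  next
    case (one i j)
    note e = one(6)[OF small(1)[of 0]] one(6)[OF small(1)[of 2]]
      one(6)[OF small(2)[of 0]] one(6)[OF small(2)[of 2]]
    \<comment> \<open>These are the listed pairs in which the block fits, that is
      \<open>q \<le> a\<close>.\<close>
    consider "a = 7" "q = 5" | "a = 11" "q = 7" using aq one by auto
    then show False
    proof cases
      case 1
      then have "i \<in> {0, 1, 2}" "j \<in> {0, 1, 2}" using one by auto
      \<comment> \<open>With shift 2 the large square has weight 0, which forces
        \<open>j = 1\<close>. With shift 0 it has weight 1, and then \<open>i\<close> must be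
        odd.\<close>
      then have "i = 1 \<and> j = 1" using e unfolding 1 sums
        by (elim insertE emptyE) (simp_all add: weights)
      then have ij: "i = 1" "j = 1" by auto
      \<comment> \<open>The block covering the corner cell starts there and has side at least 2, so
        it meets the central block in the cell \<open>(1, 1)\<close>.\<close>
      have "(0, 0) \<in> (\<Union>(i, j, n)\<in>D. {i..<i + n} \<times> {j..<j + n})" unfolding D(3) using 1 by simp
      then obtain i' j' n where d: "(i', j', n) \<in> D" "(0, 0) \<in> {i'..<i' + n} \<times> {j'..<j' + n}"
        by auto
      have "(i', j') \<in> {i'..<i' + n} \<times> {j'..<j' + n}" using d(2) by auto
      then have "(i', j') \<in> {0..<a} \<times> {0..<a}" using d(1) D(3) by blast
      then have "i' = 0" "j' = 0" using d(2) by auto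
      moreover have "n \<ge> 2" using D(2)[OF d(1)] 1 by auto
      ultimately have "(1, 1) \<in> ({i'..<i' + n} \<times> {j'..<j' + n}) \<inter> ({i..<i + q} \<times> {j..<j + q})"
        using ij 1 by auto
      moreover have "({i'..<i' + n} \<times> {j'..<j' + n}) \<inter> ({i..<i + q} \<times> {j..<j + q}) = {}"
        using disjoint_family_onD[OF D(4) d(1) one(1)] \<open>i' = 0\<close> ij by simp
      ultimately show False by blast
    next
      case 2
      then have "i \<in> {0, 1, 2, 3, 4}" "j \<in> {0, 1, 2, 3, 4}" using one by auto
      \<comment> \<open>With the sign in the first coordinate, shift 0 forces \<open>j = 2\<close>
        and shift 2 then forces \<open>i\<close> to be odd. Exchanging the coordinates gives
        \<open>i = 2\<close>, a contradiction.\<close>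
      then show False using e unfolding 2 sums
        by (elim insertE emptyE) (simp_all add: weights)
    qed
  qed
qed

theorem theorem1p5:
  fixes p a :: int
  assumes "p > 4" and "odd p" and "\<not> 3 dvd p" and "a > 0"
  shows "(a \<ge> 3 * p + 2 \<longrightarrow>
            tiled_with (square (of_int a)) {square 2, square 3, square (of_int p)}) \<and>
         (tiled_with (square (of_int a)) {square 2, square 3, square 5} \<longleftrightarrow>
            a \<notin> {1, 7}) \<and>
         (tiled_with (square (of_int a)) {square 2, square 3, square 7} \<longleftrightarrow>
            a \<notin> {1, 5, 11})"
proof (intro conjI impI iffI)
  \<comment> \<open>For \<open>p > 4\<close> the bound \<open>3 * p + 2\<close> exceeds
    \<open>2 * p + 3\<close>.\<close>
  show "tiled_with (square (of_int a)) {square 2, square 3, square (of_int p)}" if "a \<ge> 3 * p + 2"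
    using tiled_with_square_sufficient[of "{square 2, square 3, square (of_int p)}" p a] assms that
    by simp
  show "a \<notin> {1, 7}" if "tiled_with (square (of_int a)) {square 2, square 3, square 5}"
    using not_tiled_with_small_squares[of a 5] that by auto
  show "a \<notin> {1, 5, 11}" if "tiled_with (square (of_int a)) {square 2, square 3, square 7}"
    using not_tiled_with_small_squares[of a 7] that by auto
  show "tiled_with (square (of_int a)) {square 2, square 3, square 5}" if "a \<notin> {1, 7}"
  proof -
    \<comment> \<open>Below 13 the sides prime to 6 are 1, 5, 7 and 11, of which 5 and 11 are
      congruent to 5 modulo 6.\<close>
    have "even a \<or> 3 dvd a \<or> a \<ge> 5 \<and> 6 dvd a - 5 \<or> a \<ge> 2 * 5 + 3"
      using that \<open>a > 0\<close> unfolding insert_iff empty_iff by presburger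
    then show ?thesis
      using tiled_with_square_sufficient[of "{square 2, square 3, square 5}" 5 a] \<open>a > 0\<close> by simp
  qed
  show "tiled_with (square (of_int a)) {square 2, square 3, square 7}" if "a \<notin> {1, 5, 11}"
  proof -
    \<comment> \<open>Below 17 the sides prime to 6 are 1, 5, 7, 11 and 13, of which 7 and 13 are at
      least 7 and congruent to 7 modulo 6.\<close>
    have "even a \<or> 3 dvd a \<or> a \<ge> 7 \<and> 6 dvd a - 7 \<or> a \<ge> 2 * 7 + 3"
      using that \<open>a > 0\<close> unfolding insert_iff empty_iff by presburger
    then show ?thesis
      using tiled_with_square_sufficient[of "{square 2, square 3, square 7}" 7 a] \<open>a > 0\<close> by simp
  qed
qed

end
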